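(* Let $Q=\{x\in\mathbb{R}^n\mid Ax\le b\}$ be a nonempty polytope, let $\varepsilon\ge 0$, and let $\psi:\mathbb{R}^n\to(-\infty,\infty]$ be a proper convex function such that $\mathrm{relint}(\mathrm{dom}\,\psi)\cap Q\ne\emptyset$. Then $$\mathbb{P}(\mathrm{ER}(\varepsilon))=\sum_{z\in\mathrm{vert}(Q)}\gamma\big(N(z)\cap[N(z)+\partial(\varepsilon\psi)(z)]\big).$$
   Context: A polytope is a bounded polyhedron; $\mathrm{vert}(Q)$ is its finite set of vertices (extreme points). $N(x)=\{v\in\mathbb{R}^n\mid v\cdot(y-x)\le 0\ \text{for all } y\in Q\}$ is the normal cone to $Q$ at $x\in Q$. $\gamma$ is the standard Gaussian measure on $\mathbb{R}^n$. Convention: for $\varepsilon>0$, $\varepsilon\psi$ is the usual scalar multiple; for $\varepsilon=0$, $\varepsilon\psi$ denotes the indicator function $\delta_{\mathrm{dom}\,\psi}$ (equal to $0$ on $\mathrm{dom}\,\psi$ and $+\infty$ elsewhere). $\partial$ is the convex subdifferential, which may be empty (e.g. outside the domain); the Minkowski sum of any set with the empty set is empty. Let $g\sim\mathcal N(0,I_n)$. The linear program (LP) is: minimize $-g\cdot x$ over $x\in Q$. The regularized problem $(P_\varepsilon)$ is: minimize $-g\cdot x+(\varepsilon\psi)(x)$ over $x\in Q$. Since $Q$ is a polytope, with probability 1 (LP) has a unique solution $z^\star$, which is a vertex of $Q$. The exact regularization event $\mathrm{ER}(\varepsilon)$ is the event that $z^\star$ is also a solution of $(P_\varepsilon)$.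 *)

theory Defs
  imports "HOL-Probability.Probability"
begin

definition effective_domain :: "('a \<Rightarrow> ereal) \<Rightarrow> 'a set" where
  "effective_domain f = {x. f x < \<infinity>}"

text \<open>The library's \<open>epigraph\<close> and \<open>convex_on\<close> are restricted to real-valued functions;
  convexity of an extended-real-valued function is convexity of its epigraph in \<open>'a \<times> real\<close>.\<close>

definition proper_convex :: "('a::euclidean_space \<Rightarrow> ereal) \<Rightarrow> bool" where
  "proper_convex f \<longleftrightarrow>
     (\<forall>x. f x \<noteq> -\<infinity>) \<and> effective_domain f \<noteq> {} \<and>
     convex {(x, r::real). f x \<le> ereal r}"

definition indicator_fun :: "'a set \<Rightarrow> 'a \<Rightarrow> ereal" where
  "indicator_fun S x = (if x \<in> S then 0 else \<infinity>)"

text \<open>The case distinction is needed because \<open>0 * \<infinity> = 0\<close> in \<^typ>\<open>ereal\<close>, so that the plain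
  product with \<open>0\<close> would forget the domain.\<close>

definition scaled_fun :: "real \<Rightarrow> ('a \<Rightarrow> ereal) \<Rightarrow> 'a \<Rightarrow> ereal" where
  "scaled_fun \<epsilon> f =
     (if \<epsilon> = 0 then indicator_fun (effective_domain f) else (\<lambda>x. ereal \<epsilon> * f x))"

text \<open>For a function with nonempty domain this is empty at every point where the function
  is \<open>\<infinity>\<close>.\<close>

definition subdifferential :: "('a::euclidean_space \<Rightarrow> ereal) \<Rightarrow> 'a \<Rightarrow> 'a set" where
  "subdifferential f x = {v. \<forall>y. f x + ereal (v \<bullet> (y - x)) \<le> f y}"

definition normal_cone :: "'a::euclidean_space set \<Rightarrow> 'a \<Rightarrow> 'a set" where
  "normal_cone Q x = {v. \<forall>y\<in>Q. v \<bullet> (y - x) \<le> 0}"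

definition vert :: "'a::euclidean_space set \<Rightarrow> 'a set" where
  "vert Q = {x. x extreme_point_of Q}"

definition std_gaussian :: "'a::euclidean_space measure" where
  "std_gaussian = density lborel
     (\<lambda>x. ennreal ((2 * pi) powr (- real DIM('a) / 2) * exp (- (norm x)\<^sup>2 / 2)))"

definition LP_solution :: "'a::euclidean_space set \<Rightarrow> 'a \<Rightarrow> 'a \<Rightarrow> bool" where
  "LP_solution Q c z \<longleftrightarrow> is_arg_min (\<lambda>x. - (c \<bullet> x)) (\<lambda>x. x \<in> Q) z"

definition regularized_solution ::
  "'a::euclidean_space set \<Rightarrow> ('a \<Rightarrow> ereal) \<Rightarrow> real \<Rightarrow> 'a \<Rightarrow> 'a \<Rightarrow> bool" where
  "regularized_solution Q \<psi> \<epsilon> c z \<longleftrightarrow>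
     is_arg_min (\<lambda>x. ereal (- (c \<bullet> x)) + scaled_fun \<epsilon> \<psi> x) (\<lambda>x. x \<in> Q) z"

text \<open>The unique solution of the linear program exists only almost surely. Outcomes for which it
  is not unique are excluded from the event.\<close>

definition ER_event ::
  "'w measure \<Rightarrow> ('w \<Rightarrow> 'a::euclidean_space) \<Rightarrow> 'a set \<Rightarrow> ('a \<Rightarrow> ereal) \<Rightarrow> real \<Rightarrow> 'w set" where
  "ER_event M g Q \<psi> \<epsilon> = {\<omega> \<in> space M. \<exists>z.
     LP_solution Q (g \<omega>) z \<and> (\<forall>y. LP_solution Q (g \<omega>) y \<longrightarrow> y = z) \<and>
     regularized_solution Q \<psi> \<epsilon> (g \<omega>) z}"

end

theory Submission
  imports Defs
begin

text \<open>
  A point \<open>z\<close> of \<open>Q\<close> solves the linear program with cost \<open>c\<close> iff \<open>c\<close> lies in the normal cone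
  \<open>N(z)\<close>, and it solves the regularized problem iff \<open>c\<close> is a subgradient at \<open>z\<close> of \<open>\<epsilon>\<psi>\<close> plus the
  indicator function of \<open>Q\<close>. Since \<open>Q\<close> is polyhedral and meets the relative interior of the
  domain, the sum rule identifies the set of these subgradients with \<open>N(z) + \<partial>(\<epsilon>\<psi>)(z)\<close>; in
  particular this sum is closed, hence Borel. Normal cones at distinct points meet only inside a
  hyperplane, which is a Gaussian null set, so the probability splits as a sum over the vertices.
\<close>

section \<open>Lagrange multipliers for affine constraints\<close>

text \<open>Bartl's induction: if constraint \<open>k\<close> cannot be dropped, a point \<open>d0\<close> that violates only this
  constraint serves to project all functionals onto those vanishing at \<open>d0\<close>.\<close>

lemma Farkas_on_subspace:
  fixes a :: "'i \<Rightarrow> 'a::real_inner"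
  assumes "finite I" and L: "subspace L"
    and "\<And>d. d \<in> L \<Longrightarrow> (\<forall>i\<in>I. a i \<bullet> d \<le> 0) \<Longrightarrow> c \<bullet> d \<le> 0"
  shows "\<exists>\<nu>. (\<forall>i\<in>I. \<nu> i \<ge> 0) \<and> (\<forall>d\<in>L. c \<bullet> d = (\<Sum>i\<in>I. \<nu> i * (a i \<bullet> d)))"
  using assms(1,3)
proof (induction I arbitrary: a c rule: finite_induct)
  case empty
  have "c \<bullet> d = 0" if "d \<in> L" for d
    using empty(1)[OF that] empty(1)[OF subspace_neg[OF L that]] by simp
  then show ?case by auto
next
  case (insert k I)
  show ?case
  proof (cases "\<forall>d\<in>L. (\<forall>i\<in>I. a i \<bullet> d \<le> 0) \<longrightarrow> c \<bullet> d \<le> 0")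
    case True
    then obtain \<nu> where \<nu>: "\<forall>i\<in>I. \<nu> i \<ge> 0" "\<forall>d\<in>L. c \<bullet> d = (\<Sum>i\<in>I. \<nu> i * (a i \<bullet> d))"
      using insert.IH[of a c] by blast
    have "(\<Sum>i\<in>I. (\<nu>(k := 0)) i * (a i \<bullet> d)) = (\<Sum>i\<in>I. \<nu> i * (a i \<bullet> d))" for d
      using insert(2) by (intro sum.cong) auto
    then show ?thesis
      using \<nu> insert(1,2) by (intro exI[of _ "\<nu>(k := 0)"]) auto
  next
    case False
    then obtain e where e: "e \<in> L" "\<forall>i\<in>I. a i \<bullet> e \<le> 0" "c \<bullet> e > 0" by force
    have ke: "a k \<bullet> e > 0"
      using insert.prems[OF e(1)] e by force
    \<comment> \<open>Normalized so that \<open>a k \<bullet> d0 = 1\<close>; then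
      \<open>d - (a k \<bullet> d) *\<^sub>R d0\<close> is annihilated by
      \<open>a k\<close>.\<close>
    define d0 where "d0 = (1 / (a k \<bullet> e)) *\<^sub>R e"
    have d0: "d0 \<in> L" "\<forall>i\<in>I. a i \<bullet> d0 \<le> 0" "c \<bullet> d0 > 0" "a k \<bullet> d0 = 1"
      using e ke by (auto simp: d0_def L subspace_scale divide_le_0_iff)
    \<comment> \<open>Composing \<open>a i\<close> and \<open>c\<close> with this projection along
      \<open>d0\<close> gives \<open>a' i\<close> and \<open>c'\<close>, so the premise for
      \<open>I\<close> follows from the one for \<open>insert k I\<close>.\<close>
    define a' where "a' i = a i - (a i \<bullet> d0) *\<^sub>R a k" for i
    define c' where "c' = c - (c \<bullet> d0) *\<^sub>R a k"
    have "c' \<bullet> d \<le> 0" if d: "d \<in> L" "\<forall>i\<in>I. a' i \<bullet> d \<le> 0" for d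
    proof -
      define d' where "d' = d - (a k \<bullet> d) *\<^sub>R d0"
      have "d' \<in> L" using L d d0 by (simp add: d'_def subspace_diff subspace_scale)
      moreover have "\<forall>i\<in>insert k I. a i \<bullet> d' \<le> 0"
        using d d0 by (auto simp: d'_def a'_def inner_diff algebra_simps)
      ultimately have "c \<bullet> d' \<le> 0" using insert.prems by blast
      then show ?thesis by (simp add: c'_def d'_def inner_diff algebra_simps)
    qed
    then obtain \<nu> where \<nu>: "\<forall>i\<in>I. \<nu> i \<ge> 0" "\<forall>d\<in>L. c' \<bullet> d = (\<Sum>i\<in>I. \<nu> i * (a' i \<bullet> d))"
      using insert.IH[of a' c'] by blast
    \<comment> \<open>The total coefficient of \<open>a k\<close> once \<open>c'\<close> and the
      \<open>a' i\<close> are expanded. It is nonnegative because \<open>c \<bullet> d0 > 0\<close>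
      while every \<open>a i \<bullet> d0 \<le> 0\<close>.\<close>
    define \<mu> where "\<mu> = (c \<bullet> d0) - (\<Sum>i\<in>I. \<nu> i * (a i \<bullet> d0))"
    have "(\<Sum>i\<in>I. \<nu> i * (a i \<bullet> d0)) \<le> 0"
      using \<nu>(1) d0(2) by (intro sum_nonpos) (simp add: mult_nonneg_nonpos)
    then have "\<mu> \<ge> 0" using d0 by (simp add: \<mu>_def)
    moreover have "c \<bullet> d = \<mu> * (a k \<bullet> d) + (\<Sum>i\<in>I. \<nu> i * (a i \<bullet> d))" if "d \<in> L" for d
    proof -
      have "c \<bullet> d - (c \<bullet> d0) * (a k \<bullet> d) = (\<Sum>i\<in>I. \<nu> i * (a' i \<bullet> d))"
        using \<nu>(2) that by (simp add: c'_def inner_diff_left)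
      also have "\<dots> = (\<Sum>i\<in>I. \<nu> i * (a i \<bullet> d)) - (\<Sum>i\<in>I. \<nu> i * (a i \<bullet> d0)) * (a k \<bullet> d)"
        by (simp add: a'_def inner_diff_left right_diff_distrib sum_subtractf sum_distrib_right mult.assoc)
      finally show ?thesis by (simp add: \<mu>_def algebra_simps)
    qed
    moreover have "(\<Sum>i\<in>I. (\<nu>(k := \<mu>)) i * (a i \<bullet> d)) = (\<Sum>i\<in>I. \<nu> i * (a i \<bullet> d))" for d
      using insert(2) by (intro sum.cong) auto
    ultimately show ?thesis
      using \<nu>(1) insert(1,2) by (intro exI[of _ "\<nu>(k := \<mu>)"]) auto
  qed
qed

section \<open>Multiplier for a single affine constraint\<close>

text \<open>Write \<open>l x\<close> for \<open>a \<bullet> (x - z)\<close>. A multiplier must be at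
  least \<open>- h x / l x\<close> where \<open>l x > 0\<close> and at most
  \<open>h y / (- l y)\<close> where \<open>l y < 0\<close>. A segment joining two such points
  crosses the hyperplane, and convexity of \<open>h\<close> makes the bounds compatible.\<close>

lemma multiplier_one_equality:
  fixes a z :: "'a::real_inner"
  assumes h: "convex_on D h"
    and nn: "\<And>x. x \<in> D \<Longrightarrow> a \<bullet> (x - z) = 0 \<Longrightarrow> h x \<ge> 0"
    and p: "p \<in> D" "a \<bullet> (p - z) < 0" and q: "q \<in> D" "a \<bullet> (q - z) > 0"
  shows "\<exists>\<mu>. \<forall>x\<in>D. h x + \<mu> * (a \<bullet> (x - z)) \<ge> 0"
proof -
  define l where "l x = a \<bullet> (x - z)" for x
  define S where "S = (\<lambda>x. - h x / l x) ` {x\<in>D. l x > 0}"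
  have le: "- h x / l x \<le> h y / (- l y)" if "x \<in> D" "l x > 0" "y \<in> D" "l y < 0" for x y
  proof -
    \<comment> \<open>The weight for which the point \<open>w\<close> below satisfies
      \<open>l w = 0\<close>.\<close>
    define t where "t = l x / (l x - l y)"
    have t: "0 \<le> t" "t \<le> 1" "1 - t = - l y / (l x - l y)"
      using that by (auto simp: t_def field_simps)
    define w where "w = (1 - t) *\<^sub>R x + t *\<^sub>R y"
    have "w \<in> D"
      unfolding w_def using convexD_alt[OF convex_on_imp_convex[OF h] that(1,3) t(1,2)] .
    moreover have "l w = (1 - t) * l x + t * l y"
      by (simp add: l_def w_def algebra_simps inner_diff_right inner_add_right)
    then have "l w = 0"
      unfolding t(3) unfolding t_def using that by (simp add: field_simps)
    ultimately have "0 \<le> h w" using nn by (simp add: l_def)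
    also have "\<dots> \<le> (1 - t) * h x + t * h y"
      unfolding w_def using convex_onD[OF h t(1,2)] that by simp
    also have "\<dots> = (- l y * h x + l x * h y) / (l x - l y)"
      unfolding t(3) unfolding t_def by (simp add: add_divide_distrib diff_divide_distrib)
    finally have "- l y * h x + l x * h y \<ge> 0"
      using that by (simp add: zero_le_divide_iff)
    then show ?thesis using that by (simp add: field_simps)
  qed
  \<comment> \<open>\<open>q\<close> makes the set of lower bounds nonempty and \<open>p\<close>
    bounds it above, so its supremum can serve as the multiplier.\<close>
  have ne: "S \<noteq> {}" using q by (auto simp: S_def l_def)
  have bdd: "bdd_above S"
    using le p by (auto simp: S_def l_def intro!: bdd_aboveI[of _ "h p / (- l p)"])
  have "h x + Sup S * l x \<ge> 0" if x: "x \<in> D" for x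
  proof -
    consider "l x = 0" | "l x > 0" | "l x < 0" by linarith
    then show ?thesis
    proof cases
      case 1
      then show ?thesis using nn[OF x] by (simp add: l_def)
    next
      case 2
      then have "- h x / l x \<le> Sup S" using x by (intro cSup_upper bdd) (auto simp: S_def)
      then show ?thesis using 2 by (simp add: field_simps)
    next
      case 3
      then have "Sup S \<le> h x / (- l x)" using le x by (intro cSup_least ne) (auto simp: S_def)
      then show ?thesis using 3 by (simp add: field_simps)
    qed
  qed
  then show ?thesis by (auto simp: l_def)
qed

text \<open>With points on both sides of the hyperplane, the equality case gives a multiplier. If
  there are none on the positive side, or if that multiplier is negative, \<open>h\<close> is
  nonnegative on all of \<open>D\<close> and 0 serves.\<close>

lemma multiplier_one_inequality:
  fixes a z :: "'a::real_inner"
  assumes h: "convex_on D h"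
    and nn: "\<And>x. x \<in> D \<Longrightarrow> a \<bullet> (x - z) \<le> 0 \<Longrightarrow> h x \<ge> 0"
    and p: "p \<in> D" "a \<bullet> (p - z) < 0"
  shows "\<exists>\<mu>\<ge>0. \<forall>x\<in>D. h x + \<mu> * (a \<bullet> (x - z)) \<ge> 0"
proof (cases "\<exists>q\<in>D. a \<bullet> (q - z) > 0")
  case True
  then obtain \<mu> where \<mu>: "\<forall>x\<in>D. h x + \<mu> * (a \<bullet> (x - z)) \<ge> 0"
    using multiplier_one_equality[OF h nn p] by force
  show ?thesis
  proof (cases "\<mu> \<ge> 0")
    case False
    have "h x \<ge> 0" if "x \<in> D" for x
    proof (cases "a \<bullet> (x - z) \<le> 0")
      case pos: False
      then have "\<mu> * (a \<bullet> (x - z)) \<le> 0" using False by (simp add: mult_nonpos_nonneg)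
      then show ?thesis using \<mu> that by force
    qed (use nn that in auto)
    then show ?thesis by (intro exI[of _ 0]) auto
  qed (use \<mu> in blast)
next
  case False
  then have "h x \<ge> 0" if "x \<in> D" for x using nn that by force
  then show ?thesis by (intro exI[of _ 0]) auto
qed

text \<open>Keeps the partial Lagrangian convex after one constraint has been dualized, so that an
  induction hypothesis applies to it.\<close>

lemma convex_on_add_linear:
  fixes a z :: "'a::real_inner"
  assumes "convex_on D h"
  shows "convex_on D (\<lambda>x. h x + \<mu> * (a \<bullet> (x - z)))"
proof -
  have "convex_on D (\<lambda>x. \<mu> * (a \<bullet> (x - z)))"
    using convex_on_imp_convex[OF assms]
    by (intro convex_onI) (auto simp: algebra_simps inner_diff_right inner_add_right)
  then show ?thesis using assms by (rule convex_on_add[rotated])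
qed

section \<open>Multipliers for finitely many affine constraints\<close>

text \<open>The constraints are dualized one at a time, each on the slice of \<open>D\<close> cut
  out by those remaining. The condition on \<open>x0\<close> stands in for relative interiority: a
  constraint that does not vanish identically on the slice takes both signs there.\<close>

lemma multipliers_equalities:
  fixes a :: "'i \<Rightarrow> 'a::real_inner"
  assumes "finite I" and "convex_on D h"
    and x0: "x0 \<in> D" "\<And>x. x \<in> D \<Longrightarrow> \<exists>e>0. x0 - e *\<^sub>R (x - x0) \<in> D"
    and "\<forall>i\<in>I. a i \<bullet> (x0 - z) = 0"
    and "\<And>x. x \<in> D \<Longrightarrow> (\<forall>i\<in>I. a i \<bullet> (x - z) = 0) \<Longrightarrow> h x \<ge> 0"
  shows "\<exists>\<mu>. \<forall>x\<in>D. h x + (\<Sum>i\<in>I. \<mu> i * (a i \<bullet> (x - z))) \<ge> 0"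
  using assms(1,2,5,6)
proof (induction I arbitrary: h rule: finite_induct)
  case (insert k I)
  define D' where "D' = {x\<in>D. \<forall>i\<in>I. a i \<bullet> (x - z) = 0}"
  have eq: "D' = D \<inter> (\<Inter>i\<in>I. {x. a i \<bullet> x = a i \<bullet> z})"
    by (auto simp: D'_def inner_diff_right)
  have "convex D'" unfolding eq
    using convex_on_imp_convex[OF insert(4)] by (intro convex_Int convex_INT convex_hyperplane)
  then have h': "convex_on D' h"
    using insert(4) by (rule convex_on_subset[rotated -1]) (auto simp: D'_def)
  have reflect: "\<exists>y\<in>D'. (a k \<bullet> (y - z)) * (a k \<bullet> (x - z)) < 0"
    if x: "x \<in> D'" "a k \<bullet> (x - z) \<noteq> 0" for x
  proof -
    obtain e where e: "e > 0" "x0 - e *\<^sub>R (x - x0) \<in> D" using x0(2)[of x] x by (auto simp: D'_def)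
    \<comment> \<open>All constraints vanish at \<open>x0 - z\<close>, so passing beyond
      \<open>x0\<close> multiplies their values by \<open>- e\<close>: the slice is preserved and
      the sign of constraint \<open>k\<close> flips.\<close>
    have ai: "a i \<bullet> (x0 - e *\<^sub>R (x - x0) - z) = - e * (a i \<bullet> (x - z))" if "i \<in> insert k I" for i
    proof -
      have "x0 - e *\<^sub>R (x - x0) - z = (1 + e) *\<^sub>R (x0 - z) - e *\<^sub>R (x - z)"
        by (simp add: algebra_simps)
      then show ?thesis using insert.prems(2) that by (auto simp: inner_diff_right[of _ "_ *\<^sub>R _"])
    qed
    have "x0 - e *\<^sub>R (x - x0) \<in> D'" using e x ai by (simp add: D'_def)
    moreover have "(a k \<bullet> (x0 - e *\<^sub>R (x - x0) - z)) * (a k \<bullet> (x - z)) < 0"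
      using ai[of k] e x by (simp add: mult.assoc zero_less_mult_iff) linarith
    ultimately show ?thesis by blast
  qed
  have nn: "h x \<ge> 0" if "x \<in> D'" "a k \<bullet> (x - z) = 0" for x
    using insert.prems(3) that by (auto simp: D'_def)
  have "\<exists>\<mu>. \<forall>x\<in>D'. h x + \<mu> * (a k \<bullet> (x - z)) \<ge> 0"
  proof (cases "\<forall>x\<in>D'. a k \<bullet> (x - z) = 0")
    case True
    then show ?thesis using nn by auto
  next
    case False
    then obtain x where x: "x \<in> D'" "a k \<bullet> (x - z) \<noteq> 0" by blast
    obtain y where y: "y \<in> D'" "(a k \<bullet> (y - z)) * (a k \<bullet> (x - z)) < 0" using reflect[OF x] by blast
    show ?thesis
    proof (cases "a k \<bullet> (x - z) < 0")
      case True
      then have "a k \<bullet> (y - z) > 0" using y by (simp add: mult_less_0_iff)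
      then show ?thesis using multiplier_one_equality[OF h' nn x(1) True y(1)] by simp
    next
      case False
      then have "a k \<bullet> (x - z) > 0" "a k \<bullet> (y - z) < 0" using y x by (auto simp: mult_less_0_iff)
      then show ?thesis using multiplier_one_equality[OF h' nn y(1) _ x(1)] by simp
    qed
  qed
  then obtain \<mu>k where \<mu>k: "\<forall>x\<in>D'. h x + \<mu>k * (a k \<bullet> (x - z)) \<ge> 0" by blast
  \<comment> \<open>The induction hypothesis is applied to the partial Lagrangian with
    \<open>\<mu>k\<close>, which is nonnegative on \<open>D'\<close>.\<close>
  obtain \<mu> where \<mu>: "\<forall>x\<in>D. h x + \<mu>k * (a k \<bullet> (x - z)) + (\<Sum>i\<in>I. \<mu> i * (a i \<bullet> (x - z))) \<ge> 0"
    using insert.IH[OF convex_on_add_linear[OF insert(4)], of \<mu>k "a k" z] insert.prems(2) \<mu>k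
    by (auto simp: D'_def)
  have "(\<Sum>i\<in>I. (\<mu>(k := \<mu>k)) i * (a i \<bullet> d)) = (\<Sum>i\<in>I. \<mu> i * (a i \<bullet> d))" for d
    using insert(2) by (intro sum.cong) auto
  then show ?case
    using \<mu> insert(1,2) by (intro exI[of _ "\<mu>(k := \<mu>k)"]) (auto simp: add.assoc)
qed auto

text \<open>A constraint that can be satisfied strictly is dualized on its own. When none can, all the
  constraints hold with equality on the feasible set, which gives multipliers of arbitrary sign;
  Farkas' lemma on the directions of the affine hull of \<open>D\<close> then expresses every \<open>- a j\<close> as a
  nonnegative combination of the \<open>a i\<close>, so the negative multipliers can be replaced.\<close>

lemma multipliers_inequalities:
  fixes a :: "'i \<Rightarrow> 'a::euclidean_space"
  assumes "finite I" and "convex_on D h"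
    and x0: "x0 \<in> rel_interior D" and "\<forall>i\<in>I. a i \<bullet> (x0 - z) \<le> 0"
    and "\<And>x. x \<in> D \<Longrightarrow> (\<forall>i\<in>I. a i \<bullet> (x - z) \<le> 0) \<Longrightarrow> h x \<ge> 0"
  shows "\<exists>\<mu>. (\<forall>i\<in>I. \<mu> i \<ge> 0) \<and> (\<forall>x\<in>D. h x + (\<Sum>i\<in>I. \<mu> i * (a i \<bullet> (x - z))) \<ge> 0)"
  using assms(1,2,4,5)
proof (induction I arbitrary: h rule: finite_psubset_induct)
  case (psubset I)
  note fin = psubset(1) and conv = psubset.prems(1) and feas = psubset.prems(2)
    and nn = psubset.prems(3)
  have D: "convex D" using conv by (rule convex_on_imp_convex)
  show ?case
  proof (cases "\<exists>k\<in>I. \<exists>p\<in>D. (\<forall>i\<in>I. a i \<bullet> (p - z) \<le> 0) \<and> a k \<bullet> (p - z) < 0")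
    case True
    then obtain k p where k: "k \<in> I"
      and p: "p \<in> D" "\<forall>i\<in>I. a i \<bullet> (p - z) \<le> 0" "a k \<bullet> (p - z) < 0" by blast
    define D' where "D' = {x\<in>D. \<forall>i\<in>I - {k}. a i \<bullet> (x - z) \<le> 0}"
    have eq: "D' = D \<inter> (\<Inter>i\<in>I - {k}. {x. a i \<bullet> x \<le> a i \<bullet> z})"
      by (auto simp: D'_def inner_diff_right)
    have "convex D'" unfolding eq using D by (intro convex_Int convex_INT convex_halfspace_le)
    then have h': "convex_on D' h"
      using conv by (rule convex_on_subset[rotated -1]) (auto simp: D'_def)
    have "\<exists>\<mu>\<ge>0. \<forall>x\<in>D'. h x + \<mu> * (a k \<bullet> (x - z)) \<ge> 0"
      using h' p nn by (intro multiplier_one_inequality[of D' h "a k" z p]) (auto simp: D'_def)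
    then obtain \<mu>k where \<mu>k: "\<mu>k \<ge> 0" "\<forall>x\<in>D'. h x + \<mu>k * (a k \<bullet> (x - z)) \<ge> 0" by blast
    \<comment> \<open>Which constraint is removed is dictated by the strict point \<open>p\<close>;
      hence the induction over proper subsets.\<close>
    have "I - {k} \<subset> I" using k by blast
    then obtain \<mu> where \<mu>: "\<forall>i\<in>I - {k}. \<mu> i \<ge> 0"
        "\<forall>x\<in>D. h x + \<mu>k * (a k \<bullet> (x - z)) + (\<Sum>i\<in>I - {k}. \<mu> i * (a i \<bullet> (x - z))) \<ge> 0"
      using psubset.IH[OF _ convex_on_add_linear[OF conv], of "I - {k}" \<mu>k "a k" z] feas \<mu>k
      by (auto simp: D'_def)
    have "(\<Sum>i\<in>I. (\<mu>(k := \<mu>k)) i * (a i \<bullet> d))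
        = \<mu>k * (a k \<bullet> d) + (\<Sum>i\<in>I - {k}. \<mu> i * (a i \<bullet> d))" for d
      by (simp add: sum.remove[OF fin k])
    then show ?thesis
      using \<mu> \<mu>k by (intro exI[of _ "\<mu>(k := \<mu>k)"]) (auto simp: add.assoc)
  next
    case False
    then have tight: "a i \<bullet> (x - z) = 0"
      if "x \<in> D" "\<forall>i\<in>I. a i \<bullet> (x - z) \<le> 0" "i \<in> I" for x i
      using that by (meson linorder_not_le order_antisym)
    have x0D: "x0 \<in> D" using x0 rel_interior_subset by blast
    have ax0: "a i \<bullet> (x0 - z) = 0" if "i \<in> I" for i using tight[OF x0D feas that] .
    \<comment> \<open>Since \<open>x0\<close> is in the relative interior, the line from any point
      of the affine hull through \<open>x0\<close> continues a little beyond it inside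
      \<open>D\<close>.\<close>
    have reflect: "\<exists>e>0. x0 - e *\<^sub>R (x - x0) \<in> D" if x: "x \<in> affine hull D" for x
    proof -
      obtain e where e: "e > 1" "(1 - e) *\<^sub>R x + e *\<^sub>R x0 \<in> D"
        using bspec[OF convex_rel_interior_if2[OF D x0] x] by blast
      have "x0 - (e - 1) *\<^sub>R (x - x0) = (1 - e) *\<^sub>R x + e *\<^sub>R x0"
        by (simp add: algebra_simps)
      then show ?thesis using e by (intro exI[of _ "e - 1"]) simp
    qed
    have "\<exists>\<mu>. \<forall>x\<in>D. h x + (\<Sum>i\<in>I. \<mu> i * (a i \<bullet> (x - z))) \<ge> 0"
      using reflect ax0 nn by (intro multipliers_equalities[OF fin conv x0D]) (auto intro: hull_inc)
    then obtain \<mu> where \<mu>: "\<forall>x\<in>D. h x + (\<Sum>i\<in>I. \<mu> i * (a i \<bullet> (x - z))) \<ge> 0" by blast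
    define L where "L = (\<lambda>x. x - x0) ` (affine hull D)"
    have L: "subspace L"
      unfolding L_def using affine_diffs_subspace_subtract[OF affine_affine_hull hull_inc[OF x0D]] .
    \<comment> \<open>A direction in \<open>L\<close> along which no constraint increases can be
      followed from \<open>x0\<close> inside \<open>D\<close> to a feasible point; tightness there
      forces \<open>a j \<bullet> d = 0\<close>, which is the Farkas premise for
      \<open>- a j\<close>.\<close>
    have "\<exists>\<nu>. (\<forall>i\<in>I. \<nu> i \<ge> 0) \<and> (\<forall>d\<in>L. (- a j) \<bullet> d = (\<Sum>i\<in>I. \<nu> i * (a i \<bullet> d)))"
      if j: "j \<in> I" for j
    proof (rule Farkas_on_subspace[OF fin L])
      fix d assume d: "d \<in> L" "\<forall>i\<in>I. a i \<bullet> d \<le> 0"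
      have "x0 - d \<in> affine hull D"
        using subspace_neg[OF L d(1)] by (auto simp: L_def algebra_simps)
      from reflect[OF this] obtain e where e: "e > 0" "x0 + e *\<^sub>R d \<in> D" by auto
      have ai: "a i \<bullet> (x0 + e *\<^sub>R d - z) = e * (a i \<bullet> d)" if "i \<in> I" for i
        using ax0[OF that] by (simp add: inner_diff_right inner_add_right)
      have "a j \<bullet> (x0 + e *\<^sub>R d - z) = 0"
        using e d ai by (intro tight[OF _ _ j]) (simp_all add: mult_le_0_iff)
      then show "(- a j) \<bullet> d \<le> 0" using ai[OF j] e by simp
    qed
    then obtain \<nu> where \<nu>: "\<And>i j. j \<in> I \<Longrightarrow> i \<in> I \<Longrightarrow> \<nu> j i \<ge> 0"
        "\<And>j d. j \<in> I \<Longrightarrow> d \<in> L \<Longrightarrow> - (a j \<bullet> d) = (\<Sum>i\<in>I. \<nu> j i * (a i \<bullet> d))"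
      by (simp add: Bex_def Ball_def) metis
    \<comment> \<open>Positive parts are kept. For a negative \<open>\<mu> j\<close>, the term is
      read as \<open>- \<mu> j\<close> times \<open>- a j\<close>, and \<open>- a j\<close> is
      expanded with the nonnegative weights \<open>\<nu> j\<close>.\<close>
    define \<mu>' where "\<mu>' i = max (\<mu> i) 0 + (\<Sum>j\<in>I. max (- \<mu> j) 0 * \<nu> j i)" for i
    have "\<mu>' i \<ge> 0" if "i \<in> I" for i
      unfolding \<mu>'_def using \<nu>(1) that by (intro add_nonneg_nonneg sum_nonneg mult_nonneg_nonneg) auto
    moreover have "(\<Sum>i\<in>I. \<mu>' i * (a i \<bullet> (x - z))) = (\<Sum>i\<in>I. \<mu> i * (a i \<bullet> (x - z)))"
      if x: "x \<in> D" for x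
    proof -
      define d where "d = x - x0"
      have d: "d \<in> L" using x by (auto simp: d_def L_def intro: hull_inc)
      have az: "a i \<bullet> (x - z) = a i \<bullet> d" if "i \<in> I" for i
        using ax0[OF that] by (simp add: d_def inner_diff_right)
      have "(\<Sum>i\<in>I. \<mu>' i * (a i \<bullet> d))
          = (\<Sum>i\<in>I. max (\<mu> i) 0 * (a i \<bullet> d)) + (\<Sum>i\<in>I. \<Sum>j\<in>I. max (- \<mu> j) 0 * (\<nu> j i * (a i \<bullet> d)))"
        by (simp add: \<mu>'_def distrib_right sum.distrib sum_distrib_right mult.assoc)
      also have "(\<Sum>i\<in>I. \<Sum>j\<in>I. max (- \<mu> j) 0 * (\<nu> j i * (a i \<bullet> d)))
          = (\<Sum>j\<in>I. max (- \<mu> j) 0 * (\<Sum>i\<in>I. \<nu> j i * (a i \<bullet> d)))"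
        by (subst sum.swap) (simp add: sum_distrib_left)
      also have "\<dots> = (\<Sum>j\<in>I. max (- \<mu> j) 0 * (- (a j \<bullet> d)))"
        using \<nu>(2) d by (intro sum.cong) auto
      also have "(\<Sum>i\<in>I. max (\<mu> i) 0 * (a i \<bullet> d)) + \<dots> = (\<Sum>i\<in>I. \<mu> i * (a i \<bullet> d))"
        unfolding sum.distrib[symmetric] by (intro sum.cong) (auto simp: max_def)
      finally show ?thesis using az by simp
    qed
    ultimately show ?thesis using \<mu> by (intro exI[of _ \<mu>']) auto
  qed
qed

section \<open>Sum rule for a polyhedral constraint\<close>

lemma effective_domain_scaled_fun:
  "effective_domain (scaled_fun \<epsilon> \<psi>) = effective_domain \<psi>" if "\<epsilon> \<ge> 0"
proof (cases "\<epsilon> = 0")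
  case False
  have "ereal \<epsilon> * \<psi> x < \<infinity> \<longleftrightarrow> \<psi> x < \<infinity>" for x
    using that False by (cases "\<psi> x") auto
  then show ?thesis using False by (simp add: scaled_fun_def effective_domain_def)
qed (auto simp: scaled_fun_def indicator_fun_def effective_domain_def)

lemma convex_effective_domain:
  assumes "proper_convex f"
  shows "convex (effective_domain f)"
proof -
  have "effective_domain f = fst ` {(x, r::real). f x \<le> ereal r}"
  proof (intro equalityI subsetI)
    fix x assume "x \<in> effective_domain f"
    then obtain r where "f x \<le> ereal r"
      by (cases "f x") (auto simp: effective_domain_def)
    then show "x \<in> fst ` {(x, r::real). f x \<le> ereal r}" by force
  qed (auto simp: effective_domain_def dest: le_less_trans)
  then show ?thesis
    using assms by (auto simp: proper_convex_def intro!: convex_linear_image linear_fst)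
qed

lemma proper_convex_eq_ereal:
  assumes "proper_convex f" "x \<in> effective_domain f"
  shows "f x = ereal (real_of_ereal (f x))"
  using assms by (cases "f x") (auto simp: proper_convex_def effective_domain_def)

text \<open>Passes from convexity of the epigraph to the real-valued \<open>convex_on\<close> that
  the multiplier lemmas require: on the domain, the points \<open>(x, f x)\<close> themselves lie in
  the epigraph.\<close>

lemma convex_on_real_of_proper_convex:
  assumes f: "proper_convex f"
  shows "convex_on (effective_domain f) (\<lambda>x. real_of_ereal (f x))"
proof (rule convex_onI)
  fix t x y assume t: "0 < t" "t < (1::real)"
    and x: "x \<in> effective_domain f" and y: "y \<in> effective_domain f"
  have C: "convex {(x, r::real). f x \<le> ereal r}" using f by (simp add: proper_convex_def)
  have w: "(1 - t) *\<^sub>R x + t *\<^sub>R y \<in> effective_domain f"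
    using convexD_alt[OF convex_effective_domain[OF f] x y] t by simp
  have "(1 - t) *\<^sub>R (x, real_of_ereal (f x)) + t *\<^sub>R (y, real_of_ereal (f y))
      \<in> {(x, r::real). f x \<le> ereal r}"
    using convexD_alt[OF C, of "(x, real_of_ereal (f x))" "(y, real_of_ereal (f y))" t] t
      proper_convex_eq_ereal[OF f x] proper_convex_eq_ereal[OF f y] by simp
  then have "f ((1 - t) *\<^sub>R x + t *\<^sub>R y)
      \<le> ereal ((1 - t) * real_of_ereal (f x) + t * real_of_ereal (f y))"
    by simp
  then show "real_of_ereal (f ((1 - t) *\<^sub>R x + t *\<^sub>R y))
      \<le> (1 - t) * real_of_ereal (f x) + t * real_of_ereal (f y)"
    using proper_convex_eq_ereal[OF f w] by (metis ereal_less_eq(3))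
qed (rule convex_effective_domain[OF f])

text \<open>For \<open>\<epsilon> = 0\<close> the epigraph is the domain times a half-line; for
  \<open>\<epsilon> > 0\<close> it is the image of the epigraph of \<open>\<psi>\<close> under
  scaling of the last coordinate.\<close>

lemma proper_convex_scaled_fun:
  assumes "\<epsilon> \<ge> 0" and \<psi>: "proper_convex \<psi>"
  shows "proper_convex (scaled_fun \<epsilon> \<psi>)"
proof (cases "\<epsilon> = 0")
  case True
  have "{(x, r::real). indicator_fun (effective_domain \<psi>) x \<le> ereal r}
      = effective_domain \<psi> \<times> {0..}"
    by (auto simp: indicator_fun_def split: if_splits)
  then show ?thesis
    using True \<psi> convex_effective_domain[OF \<psi>] effective_domain_scaled_fun[OF assms(1), of \<psi>]
    by (simp add: proper_convex_def scaled_fun_def convex_Times) (simp add: indicator_fun_def)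
next
  case False
  then have \<epsilon>: "\<epsilon> > 0" using assms by simp
  have "{(x, r::real). ereal \<epsilon> * \<psi> x \<le> ereal r}
      = (\<lambda>(x, r). (x, \<epsilon> * r)) ` {(x, r::real). \<psi> x \<le> ereal r}" (is "?L = ?h ` ?R")
  proof (intro equalityI subsetI)
    fix p assume "p \<in> ?L"
    then have "(fst p, snd p / \<epsilon>) \<in> ?R"
      using \<epsilon> by (cases "\<psi> (fst p)") (auto simp: field_simps)
    moreover have "p = ?h (fst p, snd p / \<epsilon>)" using \<epsilon> by simp
    ultimately show "p \<in> ?h ` ?R" by (rule rev_image_eqI)
  next
    fix p assume "p \<in> ?h ` ?R"
    then obtain x r where p: "p = (x, \<epsilon> * r)" "\<psi> x \<le> ereal r" by auto
    then show "p \<in> ?L" using \<epsilon> by (cases "\<psi> x") auto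
  qed
  moreover have "linear ?h" by (auto intro!: linearI simp: algebra_simps)
  ultimately have "convex {(x, r::real). ereal \<epsilon> * \<psi> x \<le> ereal r}"
    using \<psi> by (auto simp: proper_convex_def intro!: convex_linear_image)
  moreover have "ereal \<epsilon> * \<psi> x \<noteq> -\<infinity>" for x
    using \<psi> \<epsilon> by (cases "\<psi> x") (auto simp: proper_convex_def)
  ultimately show ?thesis
    using False \<psi> effective_domain_scaled_fun[OF assms(1), of \<psi>]
    by (simp add: proper_convex_def scaled_fun_def del: ereal_times)
qed

section \<open>Subgradients relative to a polyhedron\<close>

text \<open>The right-hand side consists of the subgradients at \<open>z\<close> of \<open>f\<close>
  plus the indicator of \<open>Q\<close>. Adding the two defining inequalities gives one inclusion;
  for the other, multipliers of the constraints active at \<open>z\<close> build the normal vector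
  to be split off from \<open>c\<close>.\<close>

lemma normal_cone_plus_subdifferential:
  fixes a :: "'i \<Rightarrow> 'a::euclidean_space"
  assumes f: "proper_convex f" and I: "finite I"
    and Q: "Q = {x. \<forall>i\<in>I. a i \<bullet> x \<le> b i}" and z: "z \<in> Q"
    and ri: "rel_interior (effective_domain f) \<inter> Q \<noteq> {}"
  shows "normal_cone Q z + subdifferential f z =
    {c. f z < \<infinity> \<and> (\<forall>y\<in>Q. f z + ereal (c \<bullet> (y - z)) \<le> f y)}"
proof (intro equalityI subsetI)
  fix c assume "c \<in> normal_cone Q z + subdifferential f z"
  then obtain n v where c: "c = n + v" and n: "n \<in> normal_cone Q z" and v: "v \<in> subdifferential f z"
    by (auto elim: set_plus_elim)
  \<comment> \<open>The subgradient inequality at a point of the domain keeps \<open>f z\<close>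
    below \<infinity>.\<close>
  obtain w where "f w < \<infinity>" using f by (auto simp: proper_convex_def effective_domain_def)
  moreover have "f z + ereal (v \<bullet> (w - z)) \<le> f w" using v by (simp add: subdifferential_def)
  ultimately have "f z < \<infinity>" by (cases "f z") auto
  moreover have "f z + ereal (c \<bullet> (y - z)) \<le> f y" if "y \<in> Q" for y
  proof -
    have "f z + ereal (c \<bullet> (y - z)) \<le> f z + ereal (v \<bullet> (y - z))"
      using n that by (intro add_left_mono) (simp add: c normal_cone_def inner_add_left)
    also have "\<dots> \<le> f y" using v by (simp add: subdifferential_def)
    finally show ?thesis .
  qed
  ultimately show "c \<in> {c. f z < \<infinity> \<and> (\<forall>y\<in>Q. f z + ereal (c \<bullet> (y - z)) \<le> f y)}" by simp
next
  fix c assume "c \<in> {c. f z < \<infinity> \<and> (\<forall>y\<in>Q. f z + ereal (c \<bullet> (y - z)) \<le> f y)}"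
  then have fz: "f z < \<infinity>" and c: "\<And>y. y \<in> Q \<Longrightarrow> f z + ereal (c \<bullet> (y - z)) \<le> f y" by auto
  define D where "D = effective_domain f"
  define F where "F x = real_of_ereal (f x)" for x
  have fF: "f x = ereal (F x)" if "x \<in> D" for x
    using proper_convex_eq_ereal[OF f] that by (simp add: D_def F_def)
  have zD: "z \<in> D" using fz by (simp add: D_def effective_domain_def)
  \<comment> \<open>The gap between \<open>f\<close> and the affine function of slope
    \<open>c\<close> touching it at \<open>z\<close>, arranged to fit
    \<open>convex_on_add_linear\<close>.\<close>
  define h where "h x = F x + (-1) * (c \<bullet> (x - z)) + (- F z)" for x
  have hc: "convex_on D h"
    unfolding h_def D_def F_def
    by (intro convex_on_add[of _ _ "\<lambda>_. _"] convex_on_add_linear convex_on_real_of_proper_convex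
        convex_on_const[THEN iffD2] convex_effective_domain f)
  have hz: "h z = 0" by (simp add: h_def)
  have hQ: "h x \<ge> 0" if "x \<in> D" "x \<in> Q" for x
    using c[OF that(2)] fF[OF that(1)] fF[OF zD] by (simp add: h_def)
  \<comment> \<open>Multipliers are sought for the active constraints only, so that the resulting
    combination is normal to \<open>Q\<close> at \<open>z\<close>.\<close>
  define J where "J = {i\<in>I. a i \<bullet> z = b i}"
  have J: "finite J" "J \<subseteq> I" using I by (auto simp: J_def)
  \<comment> \<open>Here \<open>x\<close> may violate inactive constraints. These have slack at
    \<open>z\<close>, so a short step from \<open>z\<close> toward \<open>x\<close> stays in
    \<open>Q\<close>; \<open>h z = 0\<close> and convexity carry nonnegativity back to
    \<open>x\<close>.\<close>
  have nn: "h x \<ge> 0" if x: "x \<in> D" "\<forall>i\<in>J. a i \<bullet> (x - z) \<le> 0" for x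
  proof -
    have "\<forall>\<^sub>F t in at_right 0. \<forall>i\<in>I. a i \<bullet> (z + t *\<^sub>R (x - z)) \<le> b i"
    proof (rule eventually_ball_finite[OF I], rule ballI)
      fix i assume i: "i \<in> I"
      show "\<forall>\<^sub>F t in at_right 0. a i \<bullet> (z + t *\<^sub>R (x - z)) \<le> b i"
      proof (cases "i \<in> J")
        case True
        have "a i \<bullet> (z + t *\<^sub>R (x - z)) \<le> b i" if "t > 0" for t
          using True x(2) that by (simp add: J_def inner_add_right mult_le_0_iff)
        then show ?thesis by (auto simp: eventually_at_filter)
      next
        case False
        then have "a i \<bullet> z < b i" using i z by (auto simp: Q J_def less_le)
        moreover have "((\<lambda>t. a i \<bullet> (z + t *\<^sub>R (x - z))) \<longlongrightarrow> a i \<bullet> (z + 0 *\<^sub>R (x - z))) (at_right 0)"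
          by (intro tendsto_intros)
        ultimately have "\<forall>\<^sub>F t in at_right 0. a i \<bullet> (z + t *\<^sub>R (x - z)) < b i"
          by (intro order_tendstoD(2)) auto
        then show ?thesis by (rule eventually_mono) simp
      qed
    qed
    moreover have "\<forall>\<^sub>F t in at_right 0. 0 < t \<and> t < (1::real)"
      using eventually_at_right_real[of 0 "1::real"] by simp
    ultimately have "\<forall>\<^sub>F t in at_right 0.
        (\<forall>i\<in>I. a i \<bullet> (z + t *\<^sub>R (x - z)) \<le> b i) \<and> 0 < t \<and> t < (1::real)"
      by (rule eventually_conj)
    then obtain t where t: "z + t *\<^sub>R (x - z) \<in> Q" "0 < t" "t < 1"
      by (auto simp: Q dest: eventually_happens)
    have w: "z + t *\<^sub>R (x - z) = (1 - t) *\<^sub>R z + t *\<^sub>R x" by (simp add: algebra_simps)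
    have "0 \<le> h ((1 - t) *\<^sub>R z + t *\<^sub>R x)"
      using t w convexD_alt[OF convex_on_imp_convex[OF hc] zD x(1), of t] by (intro hQ) simp_all
    also have "\<dots> \<le> (1 - t) * h z + t * h x" using t convex_onD[OF hc _ _ zD x(1)] by simp
    finally show ?thesis using t by (simp add: hz zero_le_mult_iff)
  qed
  obtain x0 where x0: "x0 \<in> rel_interior D" "x0 \<in> Q" using ri by (auto simp: D_def)
  have "\<forall>i\<in>J. a i \<bullet> (x0 - z) \<le> 0" using x0 by (auto simp: Q J_def inner_diff_right)
  from multipliers_inequalities[OF J(1) hc x0(1) this nn]
  obtain \<mu> where \<mu>: "\<forall>i\<in>J. \<mu> i \<ge> 0"
      "\<forall>x\<in>D. h x + (\<Sum>i\<in>J. \<mu> i * (a i \<bullet> (x - z))) \<ge> 0"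
    by blast
  define n where "n = (\<Sum>i\<in>J. \<mu> i *\<^sub>R a i)"
  have n: "n \<bullet> d = (\<Sum>i\<in>J. \<mu> i * (a i \<bullet> d))" for d
    by (simp add: n_def inner_sum_left)
  have "n \<bullet> (y - z) \<le> 0" if "y \<in> Q" for y
    unfolding n using \<mu>(1) that
    by (intro sum_nonpos mult_nonneg_nonpos) (auto simp: Q J_def inner_diff_right)
  then have "n \<in> normal_cone Q z" by (simp add: normal_cone_def)
  \<comment> \<open>On \<open>D\<close> this is the multiplier inequality rearranged; elsewhere
    \<open>f y\<close> is \<infinity>.\<close>
  moreover have "f z + ereal ((c - n) \<bullet> (y - z)) \<le> f y" for y
  proof (cases "y \<in> D")
    case True
    then show ?thesis using \<mu>(2) fF[OF True] fF[OF zD]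
      by (auto simp: h_def n[symmetric] inner_diff_left)
  qed (simp add: D_def effective_domain_def)
  then have "c - n \<in> subdifferential f z" by (simp add: subdifferential_def)
  ultimately show "c \<in> normal_cone Q z + subdifferential f z"
    using set_plus_intro[of n _ "c - n"] by fastforce
qed

section \<open>Normal cones and the exact regularization event\<close>

lemma LP_solution_iff: "LP_solution Q c z \<longleftrightarrow> z \<in> Q \<and> c \<in> normal_cone Q z"
  by (auto simp: LP_solution_def is_arg_min_def normal_cone_def inner_diff_right not_less)

text \<open>The solutions, if any, form a face of \<open>Q\<close>. A singleton face is an extreme
  point. Conversely, a face is the hull of its extreme points, which are vertices of
  \<open>Q\<close>, so excluding the other vertices already gives uniqueness.\<close>

lemma unique_LP_solution_iff:
  assumes Q: "compact Q" "convex Q"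
  shows "LP_solution Q c z \<and> (\<forall>y. LP_solution Q c y \<longrightarrow> y = z) \<longleftrightarrow>
    z \<in> vert Q \<and> c \<in> normal_cone Q z - (\<Union>w\<in>vert Q - {z}. normal_cone Q w)" (is "?L \<longleftrightarrow> ?R")
proof -
  define F where "F = Q \<inter> {x. c \<bullet> x = c \<bullet> z}"
  have vQ: "vert Q \<subseteq> Q" by (auto simp: vert_def extreme_point_of_def)
  have face: "F face_of Q" and F: "\<And>y. LP_solution Q c y \<longleftrightarrow> y \<in> F" if "LP_solution Q c z"
  proof -
    have le: "c \<bullet> y \<le> c \<bullet> z" if "y \<in> Q" for y
      using \<open>LP_solution Q c z\<close> that
      by (auto simp: LP_solution_iff normal_cone_def inner_diff_right)
    show "F face_of Q" unfolding F_def
      using Q(2) le by (rule face_of_Int_supporting_hyperplane_le)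
    show "LP_solution Q c y \<longleftrightarrow> y \<in> F" for y
      using le that by (force simp: F_def LP_solution_iff normal_cone_def inner_diff_right)
  qed
  show ?thesis
  proof
    assume L: ?L
    then have "F = {z}" using F by blast
    then have "z \<in> vert Q" using face L by (simp add: vert_def face_of_singleton)
    then show ?R using L vQ by (auto simp: LP_solution_iff)
  next
    assume R: ?R
    then have z: "LP_solution Q c z" using vQ by (auto simp: LP_solution_iff)
    have "F = convex hull {x. x extreme_point_of F}"
      using face[OF z] Q by (intro Krein_Milman_Minkowski) (auto intro: face_of_imp_compact face_of_imp_convex)
    also have "{x. x extreme_point_of F} \<subseteq> {z}"
    proof
      fix x assume "x \<in> {x. x extreme_point_of F}"
      then have "x \<in> vert Q" "x \<in> F" using face[OF z] by (auto simp: extreme_point_of_face vert_def)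
      then show "x \<in> {z}" using R F[OF z, of x] by (auto simp: LP_solution_iff)
    qed
    then have "convex hull {x. x extreme_point_of F} \<subseteq> {z}"
      using hull_mono[of _ "{z}" convex] by simp
    finally show ?L using z F[OF z] by auto
  qed
qed

lemma closed_normal_cone: "closed (normal_cone Q z)"
proof -
  have "normal_cone Q z = (\<Inter>y\<in>Q. {c. (y - z) \<bullet> c \<le> 0})"
    by (auto simp: normal_cone_def inner_commute)
  then show ?thesis by (auto intro!: closed_INT closed_halfspace_le)
qed

text \<open>Moving the real terms across turns optimality into the inequality of the sum rule; a
  feasible point of finite value rules out minimizers of value \<infinity>.\<close>

lemma regularized_solution_iff:
  assumes "\<And>x. scaled_fun \<epsilon> \<psi> x \<noteq> -\<infinity>" and "\<exists>y\<in>Q. scaled_fun \<epsilon> \<psi> y < \<infinity>"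
  shows "regularized_solution Q \<psi> \<epsilon> c z \<longleftrightarrow> z \<in> Q \<and> scaled_fun \<epsilon> \<psi> z < \<infinity> \<and>
    (\<forall>y\<in>Q. scaled_fun \<epsilon> \<psi> z + ereal (c \<bullet> (y - z)) \<le> scaled_fun \<epsilon> \<psi> y)"
proof -
  define f where "f = scaled_fun \<epsilon> \<psi>"
  have f: "f x \<noteq> -\<infinity>" for x using assms(1) by (simp add: f_def)
  obtain w where w: "w \<in> Q" "f w < \<infinity>" using assms(2) by (auto simp: f_def)
  have eq: "ereal (- (c \<bullet> z)) + f z \<le> ereal (- (c \<bullet> y)) + f y \<longleftrightarrow> f z + ereal (c \<bullet> (y - z)) \<le> f y"
    for y
    using f[of z] f[of y] by (cases "f z"; cases "f y") (auto simp: inner_diff_right)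
  have "f z < \<infinity>" if "\<forall>y\<in>Q. f z + ereal (c \<bullet> (y - z)) \<le> f y"
    using bspec[OF that w(1)] w(2) by (cases "f z") auto
  then show ?thesis
    unfolding regularized_solution_def is_arg_min_def f_def[symmetric]
    by (auto simp: not_less eq)
qed

text \<open>An intersection of half-spaces and whole spaces if \<open>f z\<close> is finite, and
  empty otherwise. Through the sum rule this makes the Minkowski sums Borel.\<close>

lemma closed_affine_minorants:
  fixes z :: "'a::euclidean_space"
  assumes "\<And>x. f x \<noteq> -\<infinity>"
  shows "closed {c. f z < \<infinity> \<and> (\<forall>y\<in>Q. f z + ereal (c \<bullet> (y - z)) \<le> f y)}"
proof (cases "f z < \<infinity>")
  case True
  then obtain r where r: "f z = ereal r" using assms[of z] by (cases "f z") auto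
  have "closed {c. f z + ereal (c \<bullet> (y - z)) \<le> f y}" for y
  proof (cases "f y")
    case (real s)
    then have "{c. f z + ereal (c \<bullet> (y - z)) \<le> f y} = {c. (y - z) \<bullet> c \<le> s - r}"
      by (auto simp: r inner_commute)
    then show ?thesis by (simp add: closed_halfspace_le)
  qed (use assms[of y] in auto)
  then have "closed (\<Inter>y\<in>Q. {c. f z + ereal (c \<bullet> (y - z)) \<le> f y})" by (intro closed_INT) auto
  moreover have "(\<Inter>y\<in>Q. {c. f z + ereal (c \<bullet> (y - z)) \<le> f y})
      = {c. f z < \<infinity> \<and> (\<forall>y\<in>Q. f z + ereal (c \<bullet> (y - z)) \<le> f y)}"
    using True by auto
  ultimately show ?thesis by simp
qed auto

section \<open>Gaussian null sets\<close>

lemma sets_std_gaussian [simp]: "sets std_gaussian = sets borel"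
  by (simp add: std_gaussian_def)

text \<open>A cost maximized over \<open>Q\<close> at both \<open>z\<close> and \<open>w\<close> is
  orthogonal to \<open>z - w\<close>. This hyperplane is Lebesgue null, and the Gaussian measure has
  a Lebesgue density.\<close>

lemma normal_cone_Int_null:
  fixes z w :: "'a::euclidean_space"
  assumes "z \<in> Q" "w \<in> Q" "z \<noteq> w"
  shows "normal_cone Q z \<inter> normal_cone Q w \<in> null_sets std_gaussian"
proof -
  have "normal_cone Q z \<inter> normal_cone Q w \<subseteq> {c. (z - w) \<bullet> c = 0}"
    using assms(1,2) by (force simp: normal_cone_def inner_diff_right inner_diff_left inner_commute)
  moreover have "negligible {c. (z - w) \<bullet> c = 0}"
    using assms(3) by (intro negligible_hyperplane) auto
  ultimately have "negligible (normal_cone Q z \<inter> normal_cone Q w)" by (rule negligible_subset[rotated])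
  \<comment> \<open>\<open>negligible\<close> refers to the completed Lebesgue measure; Borel
    measurability brings the null set back to \<open>lborel\<close>.\<close>
  moreover have borel: "normal_cone Q z \<inter> normal_cone Q w \<in> sets lborel"
    by (auto intro!: borel_closed closed_Int closed_normal_cone)
  ultimately have "normal_cone Q z \<inter> normal_cone Q w \<in> null_sets lborel"
    by (auto simp: negligible_iff_null_sets null_sets_completion_iff)
  moreover have "absolutely_continuous lborel (std_gaussian :: 'a measure)"
    unfolding std_gaussian_def by (intro absolutely_continuousI_density) measurable
  ultimately show ?thesis by (auto simp: absolutely_continuous_def)
qed

section \<open>Probability of exact regularization\<close>

theorem theorem1p5:
  fixes A :: "real ^ 'n ^ 'm" and b :: "real ^ 'm"
    and Q :: "(real ^ 'n) set"
    and \<epsilon> :: real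
    and \<psi> :: "real ^ 'n \<Rightarrow> ereal"
    and M :: "'w measure" and g :: "'w \<Rightarrow> real ^ 'n"
  assumes Q_def: "Q = {x. A *v x \<le> b}"
    and "Q \<noteq> {}" and "bounded Q"
    and "\<epsilon> \<ge> 0"
    and "proper_convex \<psi>"
    and "rel_interior (effective_domain \<psi>) \<inter> Q \<noteq> {}"
    and "prob_space M" and "g \<in> borel_measurable M" and "distr M borel g = std_gaussian"
  shows "measure M (ER_event M g Q \<psi> \<epsilon>) =
    (\<Sum>z\<in>vert Q. measure std_gaussian
       (normal_cone Q z \<inter> (normal_cone Q z + subdifferential (scaled_fun \<epsilon> \<psi>) z)))"
proof -
  define f where "f = scaled_fun \<epsilon> \<psi>"
  define N where "N = normal_cone Q"
  define R where "R z = N z + subdifferential f z" for z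
  have Q: "Q = {x. \<forall>i\<in>UNIV. A $ i \<bullet> x \<le> b $ i}"
    by (simp add: Q_def less_eq_vec_def matrix_vector_mul_component)
  have "polyhedron Q"
  proof -
    have "Q = (\<Inter>i\<in>UNIV. {x. A $ i \<bullet> x \<le> b $ i})" by (auto simp: Q)
    then show ?thesis by (auto intro!: polyhedron_Inter polyhedron_halfspace_le)
  qed
  then have fin: "finite (vert Q)" and cpt: "compact Q" and conv: "convex Q"
    using \<open>bounded Q\<close>
    by (auto simp: vert_def finite_polyhedron_extreme_points compact_eq_bounded_closed
        polyhedron_imp_closed polyhedron_imp_convex)
  have vQ: "z \<in> Q" if "z \<in> vert Q" for z
    using that by (simp add: vert_def extreme_point_of_def)
  have f: "proper_convex f"
    unfolding f_def using assms(4,5) by (rule proper_convex_scaled_fun)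
  have f_inf: "f x \<noteq> -\<infinity>" for x using f by (simp add: proper_convex_def)
  have dom: "effective_domain f = effective_domain \<psi>"
    unfolding f_def by (rule effective_domain_scaled_fun[OF assms(4)])
  have ri: "rel_interior (effective_domain f) \<inter> Q \<noteq> {}" using assms(6) by (simp add: dom)
  then have "\<exists>y\<in>Q. f y < \<infinity>"
    using rel_interior_subset[of "effective_domain f"] by (auto simp: effective_domain_def)
  note reg = regularized_solution_iff[of \<epsilon> \<psi>, folded f_def, OF f_inf this]
  have R: "R z = {c. f z < \<infinity> \<and> (\<forall>y\<in>Q. f z + ereal (c \<bullet> (y - z)) \<le> f y)}" if "z \<in> vert Q" for z
    unfolding R_def N_def
    by (rule normal_cone_plus_subdifferential[OF f finite Q vQ[OF that] ri])
  \<comment> \<open>For a vertex \<open>z\<close>, the costs whose unique solution is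
    \<open>z\<close>. These sets are disjoint, and Borel because there are finitely many
    vertices.\<close>
  define U where "U z = N z - (\<Union>w\<in>vert Q - {z}. N w)" for z
  have N_borel: "N z \<in> sets borel" for z by (simp add: N_def closed_normal_cone borel_closed)
  have R_borel: "R z \<in> sets borel" if "z \<in> vert Q" for z
    unfolding R[OF that] by (intro borel_closed closed_affine_minorants f_inf)
  have U_borel: "U z \<in> sets borel" for z
    unfolding U_def using fin by (intro sets.Diff sets.finite_UN N_borel) auto
  define E where "E = (\<Union>z\<in>vert Q. U z \<inter> R z)"
  have E_borel: "E \<in> sets borel"
    unfolding E_def using fin U_borel R_borel by (intro sets.finite_UN sets.Int) auto
  have "ER_event M g Q \<psi> \<epsilon> = g -` E \<inter> space M"
  proof -
    have "(\<exists>z. LP_solution Q c z \<and> (\<forall>y. LP_solution Q c y \<longrightarrow> y = z) \<and> regularized_solution Q \<psi> \<epsilon> c z)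
        \<longleftrightarrow> c \<in> E" (is "?P \<longleftrightarrow> _") for c
    proof -
      have "?P \<longleftrightarrow> (\<exists>z. z \<in> vert Q \<and> c \<in> U z \<and> regularized_solution Q \<psi> \<epsilon> c z)"
        using unique_LP_solution_iff[OF cpt conv, of c] unfolding U_def N_def by metis
      also have "\<dots> \<longleftrightarrow> (\<exists>z. z \<in> vert Q \<and> c \<in> U z \<and> c \<in> R z)"
        by (intro ex_cong) (simp add: R reg vQ)
      finally show ?thesis by (auto simp: E_def)
    qed
    then show ?thesis by (auto simp: ER_event_def)
  qed
  then have "measure M (ER_event M g Q \<psi> \<epsilon>) = measure (distr M borel g) E"
    using assms(8) E_borel by (simp add: measure_distr)
  also have "\<dots> = measure std_gaussian E" by (simp add: assms(9))
  also have "\<dots> = (\<Sum>z\<in>vert Q. measure std_gaussian (U z \<inter> R z))"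
    unfolding E_def
  proof (rule finite_measure.finite_measure_finite_Union[OF _ fin])
    \<comment> \<open>Total mass one is inherited from the law of \<open>g\<close>, so no Gaussian
      integral is evaluated.\<close>
    have "prob_space (std_gaussian :: (real ^ 'n) measure)"
      using prob_space.prob_space_distr[OF assms(7,8)] by (simp add: assms(9))
    then show "finite_measure (std_gaussian :: (real ^ 'n) measure)"
      by (rule prob_space.finite_measure)
    show "(\<lambda>z. U z \<inter> R z) ` vert Q \<subseteq> sets std_gaussian" using U_borel R_borel by auto
    show "disjoint_family_on (\<lambda>z. U z \<inter> R z) (vert Q)"
      by (auto simp: disjoint_family_on_def U_def)
  qed
  also have "\<dots> = (\<Sum>z\<in>vert Q. measure std_gaussian (N z \<inter> R z))"
  proof (rule sum.cong[OF refl])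
    fix z assume z: "z \<in> vert Q"
    \<comment> \<open>Passing from \<open>U z\<close> back to \<open>N z\<close> restores only
      overlaps of normal cones, a finite union of null sets.\<close>
    have "U z \<inter> R z = N z \<inter> R z - (\<Union>w\<in>vert Q - {z}. N z \<inter> N w)" by (auto simp: U_def)
    moreover have "(\<Union>w\<in>vert Q - {z}. N z \<inter> N w) \<in> null_sets std_gaussian"
      unfolding N_def using z fin vQ
      by (intro null_sets.finite_UN normal_cone_Int_null) auto
    ultimately show "measure std_gaussian (U z \<inter> R z) = measure std_gaussian (N z \<inter> R z)"
      using N_borel R_borel[OF z] by (simp add: measure_Diff_null_set)
  qed
  finally show ?thesis by (simp add: R_def N_def f_def)
qed

end
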